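(* Let $n\ge1$, $a<b$, and let $\gamma=(\gamma_1,\dots,\gamma_n):[a,b]\to\mathbb{R}^{n}$, $\gamma\in C([a,b])\cap C^{n}((a,b))$, be such that all the leading principal minors of the $n\times n$ matrix $(\gamma'(t),\dots,\gamma^{(n)}(t))$ are positive for all $t\in(a,b)$. Then $\gamma$ is convex. In particular, for any integer $k$ with $1\le k\le n$, the equation $c_0+c_1\gamma_1(t)+\dots+c_k\gamma_k(t)=0$ has at most $k$ roots $t$ on $[a,b]$, provided that $(c_0,\dots,c_k)\in\mathbb{R}^{k+1}$ and $(c_0,\dots,c_k)\ne(0,\dots,0)$.
   Context: A curve $\gamma:[a,b]\to\mathbb{R}^n$ is called convex if no $n+1$ of its different points lie in a single affine hyperplane. *)

theory Defs
  imports "HOL-Analysis.Analysis" "Jordan_Normal_Form.DL_Submatrix" "Jordan_Normal_Form.Determinant"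
begin

(* Points of R^n are the elements of carrier_vec n, whose coordinates are numbered 0, ..., n - 1:
   the coordinate function gamma_i of a curve is vec_index (_ t) (i - 1). *)

definition coord :: "(real \<Rightarrow> real vec) \<Rightarrow> nat \<Rightarrow> real \<Rightarrow> real" where
  "coord \<gamma> i t = vec_index (\<gamma> t) i"

definition Cn_on :: "nat \<Rightarrow> real set \<Rightarrow> (real \<Rightarrow> real) \<Rightarrow> bool" where
  "Cn_on n S f \<longleftrightarrow>
     (\<forall>j<n. \<forall>t\<in>S. ((deriv ^^ j) f) differentiable (at t)) \<and>
     continuous_on S ((deriv ^^ n) f)"
  (* Meant for open S only: deriv is the two-sided derivative. *)

definition curve_deriv :: "nat \<Rightarrow> (real \<Rightarrow> real vec) \<Rightarrow> nat \<Rightarrow> real \<Rightarrow> real vec" where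
  "curve_deriv n \<gamma> j t = Matrix.vec n (\<lambda>i. (deriv ^^ j) (coord \<gamma> i) t)"

definition deriv_matrix :: "nat \<Rightarrow> (real \<Rightarrow> real vec) \<Rightarrow> real \<Rightarrow> real mat" where
  "deriv_matrix n \<gamma> t = mat_of_cols n (map (\<lambda>j. curve_deriv n \<gamma> j t) [1..<Suc n])"

definition leading_principal_minor :: "nat \<Rightarrow> 'a::comm_ring_1 mat \<Rightarrow> 'a" where
  "leading_principal_minor m A = Determinant.det (submatrix A {..<m} {..<m})"

definition affine_hyperplane :: "nat \<Rightarrow> real vec set \<Rightarrow> bool" where
  "affine_hyperplane n H \<longleftrightarrow>
     (\<exists>u\<in>carrier_vec n. \<exists>d. u \<noteq> 0\<^sub>v n \<and> H = {x \<in> carrier_vec n. scalar_prod u x = d})"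

(* Different points are distinct elements of the image of the curve. *)
definition convex_curve :: "nat \<Rightarrow> real \<Rightarrow> real \<Rightarrow> (real \<Rightarrow> real vec) \<Rightarrow> bool" where
  "convex_curve n a b \<gamma> \<longleftrightarrow>
     \<not> (\<exists>P H. P \<subseteq> \<gamma> ` {a..b} \<and> card P = n + 1 \<and> affine_hyperplane n H \<and> P \<subseteq> H)"

end

theory Submission
  imports Defs
begin

text \<open>Write \<open>f = c\<^sub>0 + c\<^sub>1 \<gamma>\<^sub>1 + \<dots> + c\<^sub>k \<gamma>\<^sub>k\<close>.  If \<open>f\<close> vanishes at \<open>k + 1\<close> points of \<open>[a, b]\<close>,
  then by Rolle's theorem \<open>f' = c\<^sub>1 \<gamma>\<^sub>1' + \<dots> + c\<^sub>k \<gamma>\<^sub>k'\<close> vanishes at \<open>k\<close> points of \<open>(a, b)\<close>, and the claim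
  becomes one about the functions \<open>\<gamma>\<^sub>i'\<close>, whose Wronskians are the given minors: only the zero
  combination of the first \<open>k\<close> of them has \<open>k\<close> zeros.

  Classically this is shown by dividing by \<open>\<gamma>\<^sub>1'\<close>, differentiating, and applying induction to the
  \<open>k - 1\<close> functions \<open>(\<gamma>\<^sub>i' / \<gamma>\<^sub>1')'\<close>, which needs Leibniz's rule and an identity for their Wronskians.
  Both are avoided here by letting the induction run over moving frames: \<open>k \<times> k\<close> arrays
  \<open>u i j t\<close> with columns satisfying \<open>u\<^sub>j' = u\<^sub>j\<^sub>+\<^sub>1 +\<close> (a combination of \<open>u\<^sub>0, \<dots>, u\<^sub>j\<close>) and with all
  leading square blocks nonsingular.  The columns \<open>\<gamma>', \<gamma>'', \<dots>, \<gamma>\<^sup>(\<^sup>k\<^sup>)\<close> form such a frame.  Eliminating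
  the first row and column (the Schur complement) turns a frame of size \<open>k + 1\<close> into a frame of size
  \<open>k\<close> (\<open>schur_step_deriv\<close>, \<open>schur_step_leading_kernel\<close>), and the first column of the new
  frame is exactly \<open>u 0 0\<close> times the derivative of the quotients \<open>u (Suc i) 0 / u 0 0\<close>
  (\<open>deriv_quotient_first_column\<close>).  So dividing by \<open>u 0 0\<close> and applying Rolle's theorem
  loses one zero and one dimension (\<open>frame_combination_trivial\<close>).

  Convexity is the case \<open>k = n\<close>: a hyperplane through \<open>n + 1\<close> points of the curve gives a
  combination with \<open>n + 1\<close> zeros.\<close>

section \<open>Rolle's theorem for finite sets of zeros\<close>

text \<open>Only continuity is assumed at boundary points of the interval, so that zeros at the ends of a
  compact interval count as well.  The inductive claim places the new zeros to the left of some old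
  zero, which keeps them apart from the one found next, between the two largest zeros.\<close>

lemma Rolle_finite_zeros:
  fixes f f' :: "real \<Rightarrow> real"
  assumes S: "is_interval S" "continuous_on S f"
    and deriv: "\<And>t. t \<in> interior S \<Longrightarrow> (f has_real_derivative f' t) (at t)"
    and Z: "finite Z" "card Z = Suc m" "Z \<subseteq> S" "\<And>z. z \<in> Z \<Longrightarrow> f z = 0"
  obtains Z' where "finite Z'" "card Z' = m" "Z' \<subseteq> interior S" "\<And>z. z \<in> Z' \<Longrightarrow> f' z = 0"
proof -
  have "\<exists>Z'. finite Z' \<and> card Z' = m \<and> Z' \<subseteq> interior S \<and> (\<forall>x\<in>Z'. f' x = 0 \<and> x < Max Z)"
    using Z
  proof (induction m arbitrary: Z)
    case 0
    then show ?case by (intro exI[of _ "{}"]) auto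
  next
    case (Suc m)
    define Y where "Y = Z - {Max Z}"
    have MZ: "Max Z \<in> Z" using Suc.prems by (intro Max_in) auto
    have Y: "finite Y" "card Y = Suc m" "Y \<subseteq> S" "\<And>z. z \<in> Y \<Longrightarrow> f z = 0"
      using Suc.prems MZ by (auto simp: Y_def)
    obtain Z' where Z': "finite Z'" "card Z' = m" "Z' \<subseteq> interior S"
      "\<forall>x\<in>Z'. f' x = 0 \<and> x < Max Y"
      using Suc.IH[OF Y] by blast
    have MY: "Max Y \<in> Y" using Y by (intro Max_in) auto
    have less: "Max Y < Max Z"
      using MY Suc.prems(1) by (auto simp: Y_def less_le)
    have sub: "{Max Y..Max Z} \<subseteq> S"
    proof
      fix x assume "x \<in> {Max Y..Max Z}"
      then show "x \<in> S"
        using mem_is_interval_1_I[OF S(1), of "Max Y" "Max Z" x] MY MZ Y(3) Suc.prems(3)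
        by (simp add: subset_iff)
    qed
    have inner: "{Max Y<..<Max Z} \<subseteq> interior S"
      using sub by (intro interior_maximal) auto
    have "\<exists>x>Max Y. x < Max Z \<and> (*) (f' x) = (\<lambda>v. 0)"
    proof (rule Rolle_deriv[OF less])
      show "f (Max Y) = f (Max Z)" using Y(4)[OF MY] Suc.prems(4)[OF MZ] by simp
      show "continuous_on {Max Y..Max Z} f" using S(2) sub by (rule continuous_on_subset)
      show "(f has_derivative (*) (f' x)) (at x)" if "Max Y < x" "x < Max Z" for x
        using deriv[of x] subsetD[OF inner, of x] that by (simp add: has_field_derivative_def)
    qed
    then obtain x where x: "Max Y < x" "x < Max Z" and "(*) (f' x) = (\<lambda>v. 0)" by blast
    then have fx: "f' x = 0" by (metis mult.right_neutral)
    show ?case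
    proof (intro exI[of _ "insert x Z'"] conjI ballI)
      show "card (insert x Z') = Suc m" using Z' x by (subst card_insert_disjoint) auto
    next
      fix y assume "y \<in> insert x Z'"
      then show "f' y = 0" "y < Max Z" using Z'(4) x fx less by force+
    qed (use Z' x inner in auto)
  qed
  then show thesis using that by blast
qed

section \<open>Elimination in moving frames\<close>

definition schur_step :: "(nat \<Rightarrow> nat \<Rightarrow> real \<Rightarrow> real) \<Rightarrow> nat \<Rightarrow> nat \<Rightarrow> real \<Rightarrow> real" where
  "schur_step u i j t = u (Suc i) (Suc j) t - u (Suc i) 0 t / u 0 0 t * u 0 (Suc j) t"

text \<open>A kernel vector of a leading block of the Schur complement lifts to a kernel vector of the
  next larger leading block: the equation of the first row determines the extra coordinate.  This
  replaces the determinant identity between the two blocks.\<close>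

lemma schur_step_leading_kernel:
  fixes x :: "nat \<Rightarrow> real"
  assumes nz: "u 0 0 t \<noteq> 0"
    and kernel: "\<And>x::nat \<Rightarrow> real. (\<And>i. i < Suc m \<Longrightarrow> (\<Sum>j<Suc m. u i j t * x j) = 0)
                   \<Longrightarrow> (\<And>j. j < Suc m \<Longrightarrow> x j = 0)"
    and x: "\<And>i. i < m \<Longrightarrow> (\<Sum>j<m. schur_step u i j t * x j) = 0"
    and j: "j < m"
  shows "x j = 0"
proof -
  define s where "s = (\<Sum>j<m. u 0 (Suc j) t * x j)"
  \<comment> \<open>The head of \<open>y\<close> solves the equation of row \<open>0\<close>.\<close>
  define y where "y = case_nat (- s / u 0 0 t) x"
  have "(\<Sum>j<Suc m. u i j t * y j) = 0" if "i < Suc m" for i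
  proof (cases i)
    case 0
    then show ?thesis
      using nz by (simp add: sum.lessThan_Suc_shift y_def s_def del: sum.lessThan_Suc)
  next
    case (Suc i')
    have "(\<Sum>j<m. schur_step u i' j t * x j)
        = (\<Sum>j<m. u i (Suc j) t * x j) - u i 0 t / u 0 0 t * s"
      unfolding s_def schur_step_def Suc sum_distrib_left sum_subtractf[symmetric]
      by (intro sum.cong) (auto simp: algebra_simps)
    then show ?thesis
      using x[of i'] that Suc
      by (simp add: sum.lessThan_Suc_shift y_def del: sum.lessThan_Suc)
  qed
  from kernel[OF this, of "Suc j"] j show ?thesis by (simp add: y_def)
qed

text \<open>The term \<open>\<mu>\<close> cancels: adding multiples of the first column to its derivative does not
  change the direction of the column, which is all that the quotients see.\<close>

lemma deriv_quotient_first_column: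
  fixes u :: "nat \<Rightarrow> nat \<Rightarrow> real \<Rightarrow> real"
  assumes nz: "u 0 0 t \<noteq> 0"
    and "(u (Suc i) 0 has_real_derivative u (Suc i) 1 t + \<mu> * u (Suc i) 0 t) (at t)"
    and "(u 0 0 has_real_derivative u 0 1 t + \<mu> * u 0 0 t) (at t)"
  shows "((\<lambda>t. u (Suc i) 0 t / u 0 0 t) has_real_derivative schur_step u i 0 t / u 0 0 t) (at t)"
  by (rule derivative_eq_intros assms refl)+ (use nz in \<open>simp add: schur_step_def field_simps\<close>)

text \<open>The Schur complement projects along the first column \<open>u\<^sub>0\<close>.  It annihilates \<open>u\<^sub>0\<close>, so the
  coefficients \<open>\<mu>\<close> shift by one place; the motion of the projection itself only adds a
  multiple of the new first column, which is the correction in the case \<open>l = 0\<close>.\<close>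

lemma schur_step_deriv:
  fixes u :: "nat \<Rightarrow> nat \<Rightarrow> real \<Rightarrow> real" and \<mu> :: "nat \<Rightarrow> nat \<Rightarrow> real \<Rightarrow> real"
  assumes nz: "u 0 0 t \<noteq> 0"
    and deriv: "\<And>p q. p \<in> {0, Suc i} \<Longrightarrow> q \<in> {0, Suc j} \<Longrightarrow>
          (u p q has_real_derivative u p (Suc q) t + (\<Sum>l\<le>q. \<mu> q l t * u p l t)) (at t)"
  defines "\<nu> \<equiv> \<lambda>j l t. \<mu> (Suc j) (Suc l) t - (if l = 0 then u 0 (Suc j) t / u 0 0 t else 0)"
  shows "(schur_step u i j has_real_derivative
           schur_step u i (Suc j) t + (\<Sum>l\<le>j. \<nu> j l t * schur_step u i l t)) (at t)"
proof -
  define w where "w t = u (Suc i) 0 t / u 0 0 t" for t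
  have w: "(w has_real_derivative schur_step u i 0 t / u 0 0 t) (at t)"
    unfolding w_def
    by (rule deriv_quotient_first_column[where \<mu> = "\<mu> 0 0 t"])
      (use nz deriv[of "Suc i" 0] deriv[of 0 0] in auto)
  have "schur_step u i j = (\<lambda>t. u (Suc i) (Suc j) t - w t * u 0 (Suc j) t)"
    by (simp add: schur_step_def w_def fun_eq_iff)
  then have D: "(schur_step u i j has_real_derivative
       (u (Suc i) (Suc (Suc j)) t + (\<Sum>l\<le>Suc j. \<mu> (Suc j) l t * u (Suc i) l t))
     - (schur_step u i 0 t / u 0 0 t * u 0 (Suc j) t
        + (u 0 (Suc (Suc j)) t + (\<Sum>l\<le>Suc j. \<mu> (Suc j) l t * u 0 l t)) * w t)) (at t)"
    using DERIV_diff[OF deriv[of "Suc i" "Suc j"] DERIV_mult[OF w deriv[of 0 "Suc j"]]] by simp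
  have shift: "(\<Sum>l\<le>Suc j. \<mu> (Suc j) l t * u (Suc i) l t) - (\<Sum>l\<le>Suc j. \<mu> (Suc j) l t * u 0 l t) * w t
      = (\<Sum>l\<le>j. \<mu> (Suc j) (Suc l) t * schur_step u i l t)" (is "?L = ?R")
  proof -
    have "?L = (\<Sum>l\<le>Suc j. \<mu> (Suc j) l t * (u (Suc i) l t - w t * u 0 l t))"
      unfolding sum_distrib_right sum_subtractf[symmetric]
      by (intro sum.cong) (auto simp: algebra_simps)
    also have "\<dots> = ?R"
      using nz by (simp add: sum.atMost_Suc_shift w_def schur_step_def del: sum.atMost_Suc)
    finally show ?thesis .
  qed
  have \<nu>: "(\<Sum>l\<le>j. \<nu> j l t * schur_step u i l t)
      = (\<Sum>l\<le>j. \<mu> (Suc j) (Suc l) t * schur_step u i l t)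
        - schur_step u i 0 t / u 0 0 t * u 0 (Suc j) t"
  proof -
    have "(\<Sum>l\<le>j. \<nu> j l t * schur_step u i l t)
      = (\<Sum>l\<le>j. \<mu> (Suc j) (Suc l) t * schur_step u i l t
          - (if l = 0 then u 0 (Suc j) t / u 0 0 t * schur_step u i l t else 0))"
      unfolding \<nu>_def by (intro sum.cong) (auto simp: algebra_simps)
    then show ?thesis by (simp add: sum_subtractf)
  qed
  have new: "schur_step u i (Suc j) t = u (Suc i) (Suc (Suc j)) t - u 0 (Suc (Suc j)) t * w t"
    by (simp add: schur_step_def w_def)
  show ?thesis
    by (rule DERIV_cong[OF D]) (unfold distrib_right, use shift \<nu> new in linarith)
qed

text \<open>A combination of the first column is divided by \<open>u 0 0\<close>; the coefficient \<open>c 0\<close> then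
  disappears on differentiating, and the remaining coefficients form a combination of the first
  column of the Schur complement with one zero less.  Nonsingularity of the leading blocks is
  expressed by trivial kernels, the form in which it passes to the Schur complement.  The
  terms in \<open>\<mu>\<close> have to be allowed because elimination creates them even where the given frame
  has none.\<close>

theorem frame_combination_trivial:
  fixes u :: "nat \<Rightarrow> nat \<Rightarrow> real \<Rightarrow> real" and \<mu> :: "nat \<Rightarrow> nat \<Rightarrow> real \<Rightarrow> real"
    and c :: "nat \<Rightarrow> real"
  assumes I: "is_interval I" "open I"
    and deriv: "\<And>i j t. i < k \<Longrightarrow> Suc j < k \<Longrightarrow> t \<in> I \<Longrightarrow>
          (u i j has_real_derivative u i (Suc j) t + (\<Sum>l\<le>j. \<mu> j l t * u i l t)) (at t)"
    and kernel: "\<And>m t x j. m \<le> k \<Longrightarrow> t \<in> I \<Longrightarrow>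
          (\<And>i. i < m \<Longrightarrow> (\<Sum>j<m. u i j t * x j) = 0) \<Longrightarrow> j < m \<Longrightarrow> x j = (0::real)"
    and Z: "finite Z" "card Z = k" "Z \<subseteq> I"
    and zero: "\<And>t. t \<in> Z \<Longrightarrow> (\<Sum>i<k. c i * u i 0 t) = 0"
    and "i < k"
  shows "c i = 0"
  using deriv kernel Z zero \<open>i < k\<close>
proof (induction k arbitrary: u \<mu> Z c i)
  case 0
  then show ?case by simp
next
  case (Suc k)
  note deriv = Suc.prems(1) and kernel = Suc.prems(2)
  have nz: "u 0 0 t \<noteq> 0" if "t \<in> I" for t
    using kernel[of 1 t "\<lambda>_. 1" 0] that by auto
  define F where "F t = c 0 + (\<Sum>i<k. c (Suc i) * (u (Suc i) 0 t / u 0 0 t))" for t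
  define F' where "F' t = (\<Sum>i<k. c (Suc i) * (schur_step u i 0 t / u 0 0 t))" for t
  have F: "F t * u 0 0 t = (\<Sum>i<Suc k. c i * u i 0 t)" if "t \<in> I" for t
    using nz[OF that] unfolding F_def sum.lessThan_Suc_shift
    by (simp add: algebra_simps sum_distrib_left)
  have FZ: "F z = 0" if "z \<in> Z" for z
    using F[of z] nz[of z] Suc.prems(5,6) that by auto
  have dF: "(F has_real_derivative F' t) (at t)" if "t \<in> I" for t
  proof -
    have "((\<lambda>t. u (Suc i) 0 t / u 0 0 t) has_real_derivative schur_step u i 0 t / u 0 0 t) (at t)"
      if "i < k" for i
      by (rule deriv_quotient_first_column[where \<mu> = "\<mu> 0 0 t"])
        (use nz deriv[of "Suc i" 0 t] deriv[of 0 0 t] \<open>t \<in> I\<close> that in auto)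
    then have "((\<lambda>t. \<Sum>i<k. c (Suc i) * (u (Suc i) 0 t / u 0 0 t)) has_real_derivative F' t) (at t)"
      unfolding F'_def by (intro DERIV_sum DERIV_cmult) auto
    from DERIV_add[OF DERIV_const this, of "c 0"] show ?thesis by (simp add: F_def[abs_def])
  qed
  have "continuous_on I F"
    using dF by (meson DERIV_isCont continuous_at_imp_continuous_on)
  then obtain Z' where Z': "finite Z'" "card Z' = k" "Z' \<subseteq> I" "\<And>z. z \<in> Z' \<Longrightarrow> F' z = 0"
    using Rolle_finite_zeros[where f = F and f' = F', OF I(1) _ _ Suc.prems(3,4,5) FZ] dF I(2)
    by (auto simp: interior_open)
  have tail: "c (Suc i) = 0" if "i < k" for i
  proof (rule Suc.IH[where c = "\<lambda>i. c (Suc i)" and u = "schur_step u" and Z = Z'])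
    fix i j t assume "i < k" "Suc j < k" "t \<in> I"
    then show "(schur_step u i j has_real_derivative schur_step u i (Suc j) t + (\<Sum>l\<le>j.
        (\<mu> (Suc j) (Suc l) t - (if l = 0 then u 0 (Suc j) t / u 0 0 t else 0)) * schur_step u i l t)) (at t)"
      by (intro schur_step_deriv) (auto intro!: nz deriv simp del: sum.atMost_Suc)
  next
    fix m t j and x :: "nat \<Rightarrow> real"
    assume "m \<le> k" "t \<in> I" "j < m" "\<And>i. i < m \<Longrightarrow> (\<Sum>j<m. schur_step u i j t * x j) = 0"
    then show "x j = 0"
      by (intro schur_step_leading_kernel[where m = m and u = u and t = t and x = x])
        (auto intro!: nz intro: kernel[of "Suc m" t] simp del: sum.lessThan_Suc)
  next
    fix t assume "t \<in> Z'"
    then have "F' t * u 0 0 t = 0" "t \<in> I" using Z' by auto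
    then show "(\<Sum>i<k. c (Suc i) * schur_step u i 0 t) = 0"
      using nz[of t] by (simp add: F'_def sum_distrib_right)
  qed (use Z' that in auto)
  show ?case
  proof (cases i)
    case 0
    obtain z where "z \<in> Z" using Suc.prems(3,4) by (metis card.empty ex_in_conv nat.distinct(1))
    from FZ[OF this] tail show ?thesis by (simp add: F_def 0)
  next
    case (Suc i')
    then show ?thesis using tail \<open>i < Suc k\<close> by simp
  qed
qed

section \<open>Leading minors and zeros along a curve\<close>

lemma pick_lessThan: "i < m \<Longrightarrow> pick {..<m} i = i"
proof -
  assume "i < m"
  then have "{a \<in> {..<m}. a < i} = {..<i}" by auto
  with \<open>i < m\<close> pick_card_in_set[of i "{..<m}"] show ?thesis by simp
qed

lemma kernel_leading_block:
  fixes A :: "real mat"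
  assumes "m \<le> dim_row A" "m \<le> dim_col A" and minor: "leading_principal_minor m A \<noteq> 0"
    and x: "\<And>i. i < m \<Longrightarrow> (\<Sum>j<m. A $$ (i, j) * x j) = 0" and "j < m"
  shows "x j = 0"
proof -
  let ?B = "submatrix A {..<m} {..<m}" and ?v = "Matrix.vec m x"
  have card: "card {i. i < dim_row A \<and> i \<in> {..<m}} = m" "card {i. i < dim_col A \<and> i \<in> {..<m}} = m"
  proof -
    have "{i. i < dim_row A \<and> i \<in> {..<m}} = {..<m}" "{i. i < dim_col A \<and> i \<in> {..<m}} = {..<m}"
      using assms(1,2) by auto
    then show "card {i. i < dim_row A \<and> i \<in> {..<m}} = m"
      "card {i. i < dim_col A \<and> i \<in> {..<m}} = m" by simp_all
  qed
  have B: "?B \<in> carrier_mat m m"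
    by (intro carrier_matI) (simp_all only: dim_submatrix card)
  have entry: "?B $$ (i, j) = A $$ (i, j)" if "i < m" "j < m" for i j
    using submatrix_index[of i A "{..<m}" j "{..<m}", unfolded card] that by (simp add: pick_lessThan)
  have "?B *\<^sub>v ?v = 0\<^sub>v m"
  proof (rule eq_vecI)
    fix i assume "i < dim_vec (0\<^sub>v m :: real vec)"
    then have i: "i < m" by simp
    have "vec_index (?B *\<^sub>v ?v) i = (\<Sum>j = 0..<m. ?B $$ (i, j) * x j)"
      using B i by (auto simp: scalar_prod_def intro!: sum.cong)
    also have "\<dots> = (\<Sum>j<m. A $$ (i, j) * x j)"
      using i by (intro sum.cong) (auto simp: entry)
    finally show "vec_index (?B *\<^sub>v ?v) i = vec_index (0\<^sub>v m) i" using x i by simp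
  qed (use B in auto)
  then have "?v = 0\<^sub>v m"
    using minor det_0_iff_vec_prod_zero_field[OF B] vec_carrier[of m x]
    unfolding leading_principal_minor_def by blast
  then show ?thesis using \<open>j < m\<close> by (metis index_vec index_zero_vec(1))
qed

lemma deriv_matrix_index:
  "i < n \<Longrightarrow> j < n \<Longrightarrow> deriv_matrix n \<gamma> t $$ (i, j) = (deriv ^^ Suc j) (coord \<gamma> i) t"
  unfolding deriv_matrix_def
  by (subst mat_of_cols_index) (auto simp: curve_deriv_def simp del: upt_Suc)

lemma Cn_on_has_deriv:
  assumes "Cn_on n S f" "j < n" "t \<in> S"
  shows "((deriv ^^ j) f has_real_derivative (deriv ^^ Suc j) f t) (at t)"
  using assms by (auto simp: Cn_on_def DERIV_deriv_iff_real_differentiable)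

text \<open>One application of Rolle's theorem removes the constant \<open>c 0\<close> and moves the zeros from the
  compact interval into its interior, where the derivatives of \<open>\<gamma>\<close> exist and form a frame with
  \<open>\<mu> = 0\<close>.\<close>

lemma combination_zeros_trivial:
  fixes \<gamma> :: "real \<Rightarrow> real vec" and c :: "nat \<Rightarrow> real"
  assumes cont: "\<And>i. i < n \<Longrightarrow> continuous_on {a..b} (coord \<gamma> i)"
    and Cn: "\<And>i. i < n \<Longrightarrow> Cn_on n {a<..<b} (coord \<gamma> i)"
    and minors: "\<And>t m. t \<in> {a<..<b} \<Longrightarrow> 1 \<le> m \<Longrightarrow> m \<le> n \<Longrightarrow>
           leading_principal_minor m (deriv_matrix n \<gamma> t) \<noteq> 0"
    and "k \<le> n"
    and Z: "finite Z" "card Z = Suc k" "Z \<subseteq> {a..b}"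
    and zero: "\<And>t. t \<in> Z \<Longrightarrow> c 0 + (\<Sum>i<k. c (Suc i) * coord \<gamma> i t) = 0"
    and "i \<le> k"
  shows "c i = 0"
proof -
  let ?u = "\<lambda>i j. (deriv ^^ Suc j) (coord \<gamma> i)"
  have D: "((deriv ^^ j) (coord \<gamma> i) has_real_derivative ?u i j t) (at t)"
    if "i < n" "j < n" "t \<in> {a<..<b}" for i j t
    using Cn_on_has_deriv[OF Cn] that by blast
  obtain Z' where Z': "finite Z'" "card Z' = k" "Z' \<subseteq> {a<..<b}"
    and zero': "\<And>z. z \<in> Z' \<Longrightarrow> (\<Sum>i<k. c (Suc i) * ?u i 0 z) = 0"
  proof (rule Rolle_finite_zeros[where f = "\<lambda>t. c 0 + (\<Sum>i<k. c (Suc i) * coord \<gamma> i t)"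
        and f' = "\<lambda>t. \<Sum>i<k. c (Suc i) * ?u i 0 t", OF _ _ _ Z zero])
    show "continuous_on {a..b} (\<lambda>t. c 0 + (\<Sum>i<k. c (Suc i) * coord \<gamma> i t))"
      using \<open>k \<le> n\<close> by (intro continuous_intros cont) auto
    show "((\<lambda>t. c 0 + (\<Sum>i<k. c (Suc i) * coord \<gamma> i t)) has_real_derivative
        (\<Sum>i<k. c (Suc i) * ?u i 0 t)) (at t)" if "t \<in> interior {a..b}" for t
    proof -
      have "((\<lambda>t. \<Sum>i<k. c (Suc i) * coord \<gamma> i t) has_real_derivative
        (\<Sum>i<k. c (Suc i) * ?u i 0 t)) (at t)"
        using D[of _ 0 t] that \<open>k \<le> n\<close>
        by (intro DERIV_sum DERIV_cmult) (auto simp: interior_atLeastAtMost_real)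
      from DERIV_add[OF DERIV_const this, of "c 0"] show ?thesis by simp
    qed
  qed (auto simp: interior_atLeastAtMost_real is_interval_cc)
  have tail: "c (Suc i) = 0" if "i < k" for i
  proof (rule frame_combination_trivial[where I = "{a<..<b}" and k = k and u = ?u
        and \<mu> = "\<lambda>_ _ _. 0" and Z = Z' and c = "\<lambda>i. c (Suc i)"])
    fix i j t assume "i < k" "Suc j < k" "t \<in> {a<..<b}"
    then show "(?u i j has_real_derivative ?u i (Suc j) t + (\<Sum>l\<le>j. 0 * ?u i l t)) (at t)"
      using D[of i "Suc j" t] \<open>k \<le> n\<close> by simp
  next
    fix m t j and x :: "nat \<Rightarrow> real"
    assume m: "m \<le> k" "t \<in> {a<..<b}" "j < m" and "\<And>i. i < m \<Longrightarrow> (\<Sum>j<m. ?u i j t * x j) = 0"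
    then have "(\<Sum>j<m. deriv_matrix n \<gamma> t $$ (i, j) * x j) = 0" if "i < m" for i
      using that \<open>k \<le> n\<close> by (simp add: deriv_matrix_index)
    then show "x j = 0"
      using m \<open>k \<le> n\<close> minors[of t m]
      by (intro kernel_leading_block[of m "deriv_matrix n \<gamma> t" x]) (auto simp: deriv_matrix_def)
  qed (use Z' zero' that in auto)
  show ?thesis
  proof (cases i)
    case 0
    obtain z where "z \<in> Z" using Z by (metis card.empty ex_in_conv nat.distinct(1))
    from zero[OF this] tail show ?thesis by (simp add: 0)
  next
    case (Suc i')
    then show ?thesis using tail \<open>i \<le> k\<close> by simp
  qed
qed

theorem corollary2p5:
  fixes n :: nat and a b :: real and \<gamma> :: "real \<Rightarrow> real vec"
  assumes "n \<ge> 1" and "a < b"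
    and "\<And>t. t \<in> {a..b} \<Longrightarrow> \<gamma> t \<in> carrier_vec n"
    and "\<And>i. i < n \<Longrightarrow> continuous_on {a..b} (coord \<gamma> i)"
    and "\<And>i. i < n \<Longrightarrow> Cn_on n {a<..<b} (coord \<gamma> i)"
    and "\<And>t m. t \<in> {a<..<b} \<Longrightarrow> 1 \<le> m \<Longrightarrow> m \<le> n \<Longrightarrow>
           leading_principal_minor m (deriv_matrix n \<gamma> t) > 0"
  shows "convex_curve n a b \<gamma> \<and>
    (\<forall>k c. 1 \<le> k \<and> k \<le> n \<and> (\<exists>i\<le>k. c i \<noteq> 0) \<longrightarrow>
       finite {t \<in> {a..b}. c 0 + (\<Sum>i=1..k. c i * coord \<gamma> (i - 1) t) = 0} \<and>
       card {t \<in> {a..b}. c 0 + (\<Sum>i=1..k. c i * coord \<gamma> (i - 1) t) = 0} \<le> k)"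
proof -
  have roots: "finite {t \<in> {a..b}. c 0 + (\<Sum>i=1..k. c i * coord \<gamma> (i - 1) t) = 0} \<and>
       card {t \<in> {a..b}. c 0 + (\<Sum>i=1..k. c i * coord \<gamma> (i - 1) t) = 0} \<le> k"
    if "k \<le> n" "\<exists>i\<le>k. c i \<noteq> 0" for k and c :: "nat \<Rightarrow> real"
  proof (rule finite_if_finite_subsets_card_bdd)
    let ?R = "{t \<in> {a..b}. c 0 + (\<Sum>i=1..k. c i * coord \<gamma> (i - 1) t) = 0}"
    fix G assume G: "G \<subseteq> ?R" "finite G"
    show "card G \<le> k"
    proof (rule ccontr)
      assume "\<not> card G \<le> k"
      then have "Suc k \<le> card G" by simp
      then obtain Z where Z: "Z \<subseteq> G" "card Z = Suc k" "finite Z"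
        by (rule obtain_subset_with_card_n)
      have "(\<Sum>i=1..k. c i * coord \<gamma> (i - 1) t) = (\<Sum>i<k. c (Suc i) * coord \<gamma> i t)" for t
        by (rule sum.reindex_bij_witness[of _ Suc "\<lambda>i. i - 1"]) auto
      then have "c 0 + (\<Sum>i<k. c (Suc i) * coord \<gamma> i t) = 0" if "t \<in> Z" for t
        using that Z(1) G(1) by auto
      moreover have "leading_principal_minor m (deriv_matrix n \<gamma> t) \<noteq> 0"
        if "t \<in> {a<..<b}" "1 \<le> m" "m \<le> n" for t m
        using assms(6)[OF that] by simp
      ultimately have "c i = 0" if "i \<le> k" for i
        using Z G that \<open>k \<le> n\<close>
        by (intro combination_zeros_trivial[where \<gamma> = \<gamma> and Z = Z and k = k and c = c, OF assms(4,5)]) auto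
      with \<open>\<exists>i\<le>k. c i \<noteq> 0\<close> show False by blast
    qed
  qed
  have "convex_curve n a b \<gamma>"
    unfolding convex_curve_def
  proof
    assume "\<exists>P H. P \<subseteq> \<gamma> ` {a..b} \<and> card P = n + 1 \<and> affine_hyperplane n H \<and> P \<subseteq> H"
    then obtain P H where P: "P \<subseteq> \<gamma> ` {a..b}" "card P = n + 1" "P \<subseteq> H"
      and "affine_hyperplane n H" by (elim exE conjE)
    then obtain u d where u: "u \<in> carrier_vec n" "u \<noteq> 0\<^sub>v n"
      and H: "H = {x \<in> carrier_vec n. scalar_prod u x = d}"
      unfolding affine_hyperplane_def by (elim bexE exE conjE)
    have hyp: "scalar_prod u x = d" if "x \<in> P" for x
      using that P(3) unfolding H by (auto dest: subsetD)
    \<comment> \<open>The equation of the hyperplane along \<open>\<gamma>\<close> is a combination with constant term \<open>- d\<close>.\<close>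
    define c where "c = case_nat (- d) (vec_index u)"
    let ?R = "{t \<in> {a..b}. c 0 + (\<Sum>i=1..n. c i * coord \<gamma> (i - 1) t) = 0}"
    have "\<exists>i<n. vec_index u i \<noteq> 0"
    proof (rule ccontr)
      assume "\<not> (\<exists>i<n. vec_index u i \<noteq> 0)"
      then have "u = 0\<^sub>v n" using u(1) by (intro eq_vecI) auto
      with u(2) show False by contradiction
    qed
    then obtain i where "i < n" "vec_index u i \<noteq> 0" by blast
    then have "\<exists>i\<le>n. c i \<noteq> 0" by (intro exI[of _ "Suc i"]) (simp add: c_def)
    note R = roots[OF order_refl this]
    have "t \<in> ?R" if "t \<in> {a..b}" "\<gamma> t \<in> P" for t
    proof -
      have "(\<Sum>i=1..n. c i * coord \<gamma> (i - 1) t) = (\<Sum>i=0..<n. vec_index u i * vec_index (\<gamma> t) i)"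
        by (rule sum.reindex_bij_witness[of _ Suc "\<lambda>i. i - 1"])
          (auto simp: c_def coord_def split: nat.split)
      also have "\<dots> = d"
        using hyp[OF that(2)] assms(3)[OF that(1)] by (simp add: scalar_prod_def)
      finally show ?thesis using that by (simp add: c_def)
    qed
    then have "P \<subseteq> \<gamma> ` ?R" using P(1) by blast
    then have "card P \<le> card ?R"
      using R by (intro surj_card_le) auto
    with P R show False by simp
  qed
  with roots show ?thesis by simp
qed

end
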